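(* Let $A\Rightarrow M$ be a Lie algebroid with a bundle of ideals $\mathfrak k$ and an IM connection $(\mathcal C,v)\in\mathcal A(A;\mathfrak k)$. The connection $\nabla=\mathcal C|_{\mathfrak k}$ on $\mathfrak k$ is $A$-invariant if and only if the bundle of ideals $\mathfrak k$ is abelian.
   Context: $\rho$ is the anchor of $A$. A bundle of ideals is a vector subbundle $\mathfrak k\subset\ker\rho\subset A$ with $[\Gamma(A),\Gamma(\mathfrak k)]\subset\Gamma(\mathfrak k)$; it is a representation of $A$ via $\nabla^A_\alpha\xi=[\alpha,\xi]$ and a bundle of Lie algebras with the restricted bracket (abelian means this bracket vanishes). An IM connection $(\mathcal C,v)\in\mathcal A(A;\mathfrak k)$ consists of an $\mathbb R$-linear map $\mathcal C\colon\Gamma(A)\to\Omega^1(M;\mathfrak k)$ and a vector bundle map $v\colon A\to\mathfrak k$ with $v|_{\mathfrak k}=\mathrm{id}_{\mathfrak k}$, $\mathcal C(f\alpha)=f\mathcal C(\alpha)+\mathrm df\otimes v(\alpha)$, and $$\mathcal C[\alpha,\beta]=\mathcal L^A_\alpha\mathcal C(\beta)-\mathcal L^A_\beta\mathcal C(\alpha),\qquad v[\alpha,\beta]=[\alpha,v(\beta)]-\iota_{\rho(\beta)}\mathcal C(\alpha)$$ for $\alpha,\beta\in\Gamma(A)$, $f\in C^\infty(M)$, where $(\mathcal L^A_\alpha\gamma)(X)=[\alpha,\gamma(X)]-\gamma([\rho(\alpha),X])$ for $\gamma\in\Omega^1(M;\mathfrak k)$. The linear connection $\nabla=\mathcal C|_{\mathfrak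 k}$ is $\nabla_X\xi=\mathcal C(\xi)(X)$. A linear connection $\nabla$ on $\mathfrak k$ is $A$-invariant if $\nabla^A_\alpha=\nabla_{\rho(\alpha)}$ and $\iota_{\rho(\alpha)}R^\nabla=0$ for all $\alpha\in A$, $R^\nabla$ being its curvature. *)

theory Defs
  imports "HOL-Analysis.Analysis" "HOL-Library.Function_Algebras"
begin

section \<open>Smooth maps between finite-dimensional vector spaces\<close>

text \<open>Model spaces. In contrast to \<open>euclidean_space\<close>, the zero space is admitted, so that
  zero-dimensional manifolds and vector bundles of rank zero are covered.\<close>

class finite_dim_normed = real_normed_vector +
  assumes finite_spanning_set: "\<exists>B. finite B \<and> (\<forall>x. \<exists>c. x = (\<Sum>b\<in>B. c b *\<^sub>R b))"

instance euclidean_space \<subseteq> finite_dim_normed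
  by standard (metis finite_Basis euclidean_representation)

text \<open>Both notions are meant for open \<open>S\<close> and a finite-dimensional domain, where being of class
  \<open>C\<^sup>k\<^sup>+\<^sup>1\<close> amounts to being differentiable with all directional derivatives of class \<open>C\<^sup>k\<close>.\<close>

primrec Ck_on :: "nat \<Rightarrow> 'a::real_normed_vector set \<Rightarrow> ('a \<Rightarrow> 'b::real_normed_vector) \<Rightarrow> bool" where
  "Ck_on 0 S f \<longleftrightarrow> continuous_on S f"
| "Ck_on (Suc k) S f \<longleftrightarrow> (\<forall>x\<in>S. f differentiable (at x)) \<and>
     (\<forall>u. Ck_on k S (\<lambda>x. frechet_derivative f (at x) u))"

definition smooth_on :: "'a::real_normed_vector set \<Rightarrow> ('a \<Rightarrow> 'b::real_normed_vector) \<Rightarrow> bool" where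
  "smooth_on S f \<longleftrightarrow> (\<forall>k. Ck_on k S f)"


section \<open>Manifolds\<close>

text \<open>The points of the manifold \<open>M\<close> are the elements of the type \<open>'m\<close>. A chart is a pair of its
  domain \<open>U\<close> and a coordinate map, of which only the values on \<open>U\<close> matter.\<close>

type_synonym ('m, 'e) chart = "'m set \<times> ('m \<Rightarrow> 'e)"

definition smooth_atlas :: "('m, 'e::finite_dim_normed) chart set \<Rightarrow> bool" where
  "smooth_atlas atlas \<longleftrightarrow>
     (\<Union>(U, \<phi>)\<in>atlas. U) = UNIV \<and>
     (\<forall>(U, \<phi>)\<in>atlas. inj_on \<phi> U \<and> open (\<phi> ` U)) \<and>
     (\<forall>(U, \<phi>)\<in>atlas. \<forall>(V, \<psi>)\<in>atlas.
        open (\<phi> ` (U \<inter> V)) \<and> smooth_on (\<phi> ` (U \<inter> V)) (\<psi> \<circ> inv_into U \<phi>))"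

text \<open>The topology of the manifold is the one for which all charts are homeomorphisms onto open
  sets.\<close>

definition atlas_topology :: "('m, 'e::finite_dim_normed) chart set \<Rightarrow> 'm topology" where
  "atlas_topology atlas = topology (\<lambda>W. \<forall>(U, \<phi>)\<in>atlas. open (\<phi> ` (U \<inter> W)))"

lemma openin_atlas_topology:
  assumes "smooth_atlas atlas"
  shows "openin (atlas_topology atlas) W \<longleftrightarrow> (\<forall>(U, \<phi>)\<in>atlas. open (\<phi> ` (U \<inter> W)))"
proof -
  have inj: "inj_on \<phi> U" if "(U, \<phi>) \<in> atlas" for U \<phi>
    using assms that by (auto simp: smooth_atlas_def)
  have int: "\<phi> ` (U \<inter> (S \<inter> T)) = \<phi> ` (U \<inter> S) \<inter> \<phi> ` (U \<inter> T)"
    if "(U, \<phi>) \<in> atlas" for U \<phi> S T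
    using inj[OF that] by (fastforce simp: inj_on_def)
  have "istopology (\<lambda>W. \<forall>(U, \<phi>)\<in>atlas. open (\<phi> ` (U \<inter> W)))"
    unfolding istopology_def
  proof (intro conjI allI impI)
    fix S T
    assume "\<forall>(U, \<phi>)\<in>atlas. open (\<phi> ` (U \<inter> S))" "\<forall>(U, \<phi>)\<in>atlas. open (\<phi> ` (U \<inter> T))"
    then show "\<forall>(U, \<phi>)\<in>atlas. open (\<phi> ` (U \<inter> (S \<inter> T)))"
      using int by fastforce
  next
    fix K
    assume K: "\<forall>W\<in>K. \<forall>(U, \<phi>)\<in>atlas. open (\<phi> ` (U \<inter> W))"
    have "\<phi> ` (U \<inter> \<Union>K) = (\<Union>W\<in>K. \<phi> ` (U \<inter> W))" for \<phi> :: "'a \<Rightarrow> 'b" and U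
      by auto
    then show "\<forall>(U, \<phi>)\<in>atlas. open (\<phi> ` (U \<inter> \<Union>K))"
      using K by fastforce
  qed
  then show ?thesis
    by (simp add: atlas_topology_def)
qed

definition smooth_manifold :: "('m, 'e::finite_dim_normed) chart set \<Rightarrow> bool" where
  "smooth_manifold atlas \<longleftrightarrow> smooth_atlas atlas \<and>
     Hausdorff_space (atlas_topology atlas) \<and> second_countable (atlas_topology atlas)"

text \<open>Smoothness on an open subset \<open>W\<close> of the manifold:\<close>

definition smooth_map_on ::
    "('m, 'e::finite_dim_normed) chart set \<Rightarrow> 'm set \<Rightarrow> ('m \<Rightarrow> 'b::real_normed_vector) \<Rightarrow> bool" where
  "smooth_map_on atlas W f \<longleftrightarrow>
     (\<forall>(U, \<phi>)\<in>atlas. smooth_on (\<phi> ` (U \<inter> W)) (f \<circ> inv_into U \<phi>))"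

definition smooth_functions :: "('m, 'e::finite_dim_normed) chart set \<Rightarrow> ('m \<Rightarrow> real) set" where
  "smooth_functions atlas = {f. smooth_map_on atlas UNIV f}"


section \<open>Vector bundles\<close>

text \<open>The fibres are finite-dimensional linear subspaces of some (purely algebraic, arbitrarily
  large) real vector space \<open>'a\<close>. The smooth structure is given by a cover by local
  trivialisations: in \<open>(U, \<tau>)\<close> the map \<open>\<tau> p\<close> identifies the fibre over \<open>p \<in> U\<close> with the model
  fibre \<open>'f\<close>.\<close>

record ('m, 'a, 'f) vbundle =
  fibre :: "'m \<Rightarrow> 'a set"
  trivs :: "('m set \<times> ('m \<Rightarrow> 'a \<Rightarrow> 'f)) set"

definition linear_between ::
    "'a::real_vector set \<Rightarrow> 'b::real_vector set \<Rightarrow> ('a \<Rightarrow> 'b) \<Rightarrow> bool" where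
  "linear_between V W f \<longleftrightarrow> f ` V \<subseteq> W \<and>
     (\<forall>x\<in>V. \<forall>y\<in>V. f (x + y) = f x + f y) \<and> (\<forall>r. \<forall>x\<in>V. f (r *\<^sub>R x) = r *\<^sub>R f x)"

text \<open>A fibre preserving map \<open>F\<close> over the identity of \<open>M\<close> is given by its restrictions \<open>F p\<close> to
  the fibres. It is smooth if \<open>(p, e) \<mapsto> \<sigma> p (F p ((\<tau> p)\<^sup>-\<^sup>1 e))\<close> is smooth for all trivialisations
  \<open>\<tau>\<close>, \<open>\<sigma>\<close>.\<close>

definition smooth_fibre_map ::
    "('m, 'e::finite_dim_normed) chart set \<Rightarrow>
     ('m, 'a::real_vector, 'f::finite_dim_normed) vbundle \<Rightarrow>
     ('m, 'b::real_vector, 'g::finite_dim_normed) vbundle \<Rightarrow> ('m \<Rightarrow> 'a \<Rightarrow> 'b) \<Rightarrow> bool" where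
  "smooth_fibre_map atlas E E' F \<longleftrightarrow>
     (\<forall>(W, \<phi>)\<in>atlas. \<forall>(U, \<tau>)\<in>trivs E. \<forall>(V, \<sigma>)\<in>trivs E'.
        smooth_on (\<phi> ` (W \<inter> U \<inter> V) \<times> UNIV)
          (\<lambda>(x, e). let p = inv_into W \<phi> x in \<sigma> p (F p (inv_into (fibre E p) (\<tau> p) e))))"

definition bundle_map ::
    "('m, 'e::finite_dim_normed) chart set \<Rightarrow>
     ('m, 'a::real_vector, 'f::finite_dim_normed) vbundle \<Rightarrow>
     ('m, 'b::real_vector, 'g::finite_dim_normed) vbundle \<Rightarrow> ('m \<Rightarrow> 'a \<Rightarrow> 'b) \<Rightarrow> bool" where
  "bundle_map atlas E E' F \<longleftrightarrow>
     (\<forall>p. linear_between (fibre E p) (fibre E' p) (F p)) \<and> smooth_fibre_map atlas E E' F"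

text \<open>Smoothness of the identity as a fibre map says that the transition functions are smooth.\<close>

locale vector_bundle =
  fixes atlas :: "('m, 'e::finite_dim_normed) chart set"
    and E :: "('m, 'a::real_vector, 'f::finite_dim_normed) vbundle"
  assumes manifold: "smooth_manifold atlas"
    and subspace_fibre: "subspace (fibre E p)"
    and trivs_cover: "(\<Union>(U, \<tau>)\<in>trivs E. U) = UNIV"
    and open_triv: "(U, \<tau>) \<in> trivs E \<Longrightarrow> openin (atlas_topology atlas) U"
    and linear_triv: "(U, \<tau>) \<in> trivs E \<Longrightarrow> p \<in> U \<Longrightarrow> linear_between (fibre E p) UNIV (\<tau> p)"
    and bij_triv: "(U, \<tau>) \<in> trivs E \<Longrightarrow> p \<in> U \<Longrightarrow> bij_betw (\<tau> p) (fibre E p) UNIV"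
    and smooth_transition: "smooth_fibre_map atlas E E (\<lambda>p a. a)"

definition sections ::
    "('m, 'e::finite_dim_normed) chart set \<Rightarrow>
     ('m, 'a::real_vector, 'f::finite_dim_normed) vbundle \<Rightarrow> ('m \<Rightarrow> 'a) set" where
  "sections atlas E = {\<alpha>. (\<forall>p. \<alpha> p \<in> fibre E p) \<and>
     (\<forall>(U, \<tau>)\<in>trivs E. smooth_map_on atlas U (\<lambda>p. \<tau> p (\<alpha> p)))}"

text \<open>The module structure over the smooth functions; addition of sections is the pointwise
  addition of functions.\<close>

definition fun_scale :: "('m \<Rightarrow> real) \<Rightarrow> ('m \<Rightarrow> 'a::real_vector) \<Rightarrow> 'm \<Rightarrow> 'a" where
  "fun_scale f \<alpha> = (\<lambda>p. f p *\<^sub>R \<alpha> p)"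

text \<open>A subbundle carries its own local trivialisations; the inclusion is a fibrewise injective
  bundle map of constant rank, hence an embedding, which determines the smooth structure.\<close>

definition vector_subbundle ::
    "('m, 'e::finite_dim_normed) chart set \<Rightarrow>
     ('m, 'a::real_vector, 'g::finite_dim_normed) vbundle \<Rightarrow>
     ('m, 'a, 'f::finite_dim_normed) vbundle \<Rightarrow> bool" where
  "vector_subbundle atlas K E \<longleftrightarrow> vector_bundle atlas K \<and> vector_bundle atlas E \<and>
     (\<forall>p. fibre K p \<subseteq> fibre E p) \<and> bundle_map atlas K E (\<lambda>p a. a)"


section \<open>The tangent bundle\<close>

instantiation "fun" :: (type, real_vector) real_vector
begin

definition scaleR_fun :: "real \<Rightarrow> ('a \<Rightarrow> 'b) \<Rightarrow> 'a \<Rightarrow> 'b" where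
  "scaleR_fun r f = (\<lambda>x. r *\<^sub>R f x)"

instance
  by standard (auto simp: scaleR_fun_def fun_eq_iff scaleR_add_left scaleR_add_right)

end

text \<open>A tangent vector at \<open>p\<close> assigns to every chart around \<open>p\<close> its coordinate vector in that chart,
  subject to the usual transformation law (and \<open>0\<close> to everything that is not a chart around \<open>p\<close>, to
  make the representation unique).\<close>

type_synonym ('m, 'e) tvec = "('m, 'e) chart \<Rightarrow> 'e"

definition tangent_space :: "('m, 'e::finite_dim_normed) chart set \<Rightarrow> 'm \<Rightarrow> ('m, 'e) tvec set" where
  "tangent_space atlas p = {w.
     (\<forall>c. c \<notin> atlas \<or> p \<notin> fst c \<longrightarrow> w c = 0) \<and>
     (\<forall>(U, \<phi>)\<in>atlas. \<forall>(V, \<psi>)\<in>atlas. p \<in> U \<inter> V \<longrightarrow>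
        w (V, \<psi>) = frechet_derivative (\<psi> \<circ> inv_into U \<phi>) (at (\<phi> p)) (w (U, \<phi>)))}"

definition tangent_bundle ::
    "('m, 'e::finite_dim_normed) chart set \<Rightarrow> ('m, ('m, 'e) tvec, 'e) vbundle" where
  "tangent_bundle atlas =
     \<lparr>fibre = tangent_space atlas, trivs = (\<lambda>c. (fst c, \<lambda>p w. w c)) ` atlas\<rparr>"

abbreviation vector_fields :: "('m, 'e::finite_dim_normed) chart set \<Rightarrow> ('m \<Rightarrow> ('m, 'e) tvec) set" where
  "vector_fields atlas \<equiv> sections atlas (tangent_bundle atlas)"

text \<open>\<open>differential atlas f p w\<close> is \<open>df\<^sub>p(w)\<close>, computed in some chart around \<open>p\<close>; by the
  transformation law the choice does not matter for \<open>w\<close> tangent at \<open>p\<close>.\<close>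

definition differential ::
    "('m, 'e::finite_dim_normed) chart set \<Rightarrow> ('m \<Rightarrow> real) \<Rightarrow> 'm \<Rightarrow> ('m, 'e) tvec \<Rightarrow> real" where
  "differential atlas f p w =
     (let (U, \<phi>) = (SOME c. c \<in> atlas \<and> p \<in> fst c)
      in frechet_derivative (f \<circ> inv_into U \<phi>) (at (\<phi> p)) (w (U, \<phi>)))"

definition vf_bracket ::
    "('m, 'e::finite_dim_normed) chart set \<Rightarrow>
     ('m \<Rightarrow> ('m, 'e) tvec) \<Rightarrow> ('m \<Rightarrow> ('m, 'e) tvec) \<Rightarrow> 'm \<Rightarrow> ('m, 'e) tvec" where
  "vf_bracket atlas X Y = (\<lambda>p (U, \<phi>).
     if (U, \<phi>) \<in> atlas \<and> p \<in> U then
       frechet_derivative (\<lambda>x. Y (inv_into U \<phi> x) (U, \<phi>)) (at (\<phi> p)) (X p (U, \<phi>)) -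
       frechet_derivative (\<lambda>x. X (inv_into U \<phi> x) (U, \<phi>)) (at (\<phi> p)) (Y p (U, \<phi>))
     else 0)"

text \<open>For a vector bundle map \<open>F\<close> over the identity, \<open>apply_map F \<alpha>\<close> is the section
  \<open>p \<mapsto> F\<^sub>p(\<alpha>(p))\<close>.\<close>

definition apply_map :: "('m \<Rightarrow> 'a \<Rightarrow> 'b) \<Rightarrow> ('m \<Rightarrow> 'a) \<Rightarrow> 'm \<Rightarrow> 'b" where
  "apply_map F \<alpha> = (\<lambda>p. F p (\<alpha> p))"

text \<open>One-forms with values in \<open>E\<close> are vector bundle maps \<open>TM \<rightarrow> E\<close>; evaluation of a form on a
  vector field is \<^const>\<open>apply_map\<close>.\<close>

definition one_forms ::
    "('m, 'e::finite_dim_normed) chart set \<Rightarrow>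
     ('m, 'a::real_vector, 'f::finite_dim_normed) vbundle \<Rightarrow> ('m \<Rightarrow> ('m, 'e) tvec \<Rightarrow> 'a) set" where
  "one_forms atlas E = {\<gamma>. bundle_map atlas (tangent_bundle atlas) E \<gamma>}"


section \<open>Linear connections\<close>

text \<open>A connection is given by \<open>(X, \<xi>) \<mapsto> \<nabla>\<^sub>X \<xi>\<close> on vector fields and sections.\<close>

type_synonym ('m, 'e, 'a) connection = "('m \<Rightarrow> ('m, 'e) tvec) \<Rightarrow> ('m \<Rightarrow> 'a) \<Rightarrow> 'm \<Rightarrow> 'a"

locale linear_connection = vector_bundle atlas E
  for atlas :: "('m, 'e::finite_dim_normed) chart set"
    and E :: "('m, 'a::real_vector, 'f::finite_dim_normed) vbundle" +
  fixes nabla :: "('m, 'e, 'a) connection"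
  assumes nabla_section:
      "X \<in> vector_fields atlas \<Longrightarrow> \<xi> \<in> sections atlas E \<Longrightarrow> nabla X \<xi> \<in> sections atlas E"
    and nabla_add_left:
      "X \<in> vector_fields atlas \<Longrightarrow> Y \<in> vector_fields atlas \<Longrightarrow> \<xi> \<in> sections atlas E \<Longrightarrow>
       nabla (X + Y) \<xi> = nabla X \<xi> + nabla Y \<xi>"
    and nabla_scale_left:
      "f \<in> smooth_functions atlas \<Longrightarrow> X \<in> vector_fields atlas \<Longrightarrow> \<xi> \<in> sections atlas E \<Longrightarrow>
       nabla (fun_scale f X) \<xi> = fun_scale f (nabla X \<xi>)"
    and nabla_add_right:
      "X \<in> vector_fields atlas \<Longrightarrow> \<xi> \<in> sections atlas E \<Longrightarrow> \<eta> \<in> sections atlas E \<Longrightarrow>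
       nabla X (\<xi> + \<eta>) = nabla X \<xi> + nabla X \<eta>"
    and nabla_leibniz:
      "f \<in> smooth_functions atlas \<Longrightarrow> X \<in> vector_fields atlas \<Longrightarrow> \<xi> \<in> sections atlas E \<Longrightarrow>
       nabla X (fun_scale f \<xi>) =
         fun_scale f (nabla X \<xi>) + fun_scale (apply_map (differential atlas f) X) \<xi>"

definition curvature ::
    "('m, 'e::finite_dim_normed) chart set \<Rightarrow> ('m, 'e, 'a::real_vector) connection \<Rightarrow>
     ('m \<Rightarrow> ('m, 'e) tvec) \<Rightarrow> ('m \<Rightarrow> ('m, 'e) tvec) \<Rightarrow> ('m \<Rightarrow> 'a) \<Rightarrow> 'm \<Rightarrow> 'a" where
  "curvature atlas nabla X Y \<xi> =
     nabla X (nabla Y \<xi>) - nabla Y (nabla X \<xi>) - nabla (vf_bracket atlas X Y) \<xi>"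


section \<open>Lie algebroids and bundles of ideals\<close>

type_synonym ('m, 'a) section_bracket = "('m \<Rightarrow> 'a) \<Rightarrow> ('m \<Rightarrow> 'a) \<Rightarrow> 'm \<Rightarrow> 'a"

text \<open>That the anchor is a homomorphism of brackets is a consequence of these axioms.\<close>

locale lie_algebroid = vector_bundle atlas A
  for atlas :: "('m, 'e::finite_dim_normed) chart set"
    and A :: "('m, 'a::real_vector, 'f::finite_dim_normed) vbundle" +
  fixes anchor :: "'m \<Rightarrow> 'a \<Rightarrow> ('m, 'e) tvec"
    and bracket :: "('m, 'a) section_bracket"
  assumes anchor_map: "bundle_map atlas A (tangent_bundle atlas) anchor"
    and bracket_section:
      "\<alpha> \<in> sections atlas A \<Longrightarrow> \<beta> \<in> sections atlas A \<Longrightarrow> bracket \<alpha> \<beta> \<in> sections atlas A"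
    and bracket_add:
      "\<alpha> \<in> sections atlas A \<Longrightarrow> \<beta> \<in> sections atlas A \<Longrightarrow> \<gamma> \<in> sections atlas A \<Longrightarrow>
       bracket \<alpha> (\<beta> + \<gamma>) = bracket \<alpha> \<beta> + bracket \<alpha> \<gamma>"
    and bracket_scaleR:
      "\<alpha> \<in> sections atlas A \<Longrightarrow> \<beta> \<in> sections atlas A \<Longrightarrow>
       bracket \<alpha> (r *\<^sub>R \<beta>) = r *\<^sub>R bracket \<alpha> \<beta>"
    and bracket_skew:
      "\<alpha> \<in> sections atlas A \<Longrightarrow> \<beta> \<in> sections atlas A \<Longrightarrow> bracket \<alpha> \<beta> = - bracket \<beta> \<alpha>"
    and bracket_jacobi:
      "\<alpha> \<in> sections atlas A \<Longrightarrow> \<beta> \<in> sections atlas A \<Longrightarrow> \<gamma> \<in> sections atlas A \<Longrightarrow>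
       bracket \<alpha> (bracket \<beta> \<gamma>) + bracket \<beta> (bracket \<gamma> \<alpha>) + bracket \<gamma> (bracket \<alpha> \<beta>) = 0"
    and bracket_leibniz:
      "\<alpha> \<in> sections atlas A \<Longrightarrow> \<beta> \<in> sections atlas A \<Longrightarrow> f \<in> smooth_functions atlas \<Longrightarrow>
       bracket \<alpha> (fun_scale f \<beta>) =
         fun_scale f (bracket \<alpha> \<beta>) +
         fun_scale (apply_map (differential atlas f) (apply_map anchor \<alpha>)) \<beta>"

locale bundle_of_ideals = lie_algebroid atlas A anchor bracket
  for atlas :: "('m, 'e::finite_dim_normed) chart set"
    and A :: "('m, 'a::real_vector, 'f::finite_dim_normed) vbundle"
    and anchor :: "'m \<Rightarrow> 'a \<Rightarrow> ('m, 'e) tvec"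
    and bracket :: "('m, 'a) section_bracket" +
  fixes K :: "('m, 'a, 'g::finite_dim_normed) vbundle"
  assumes subbundle: "vector_subbundle atlas K A"
    and ker_anchor: "x \<in> fibre K p \<Longrightarrow> anchor p x = 0"
    and ideal: "\<alpha> \<in> sections atlas A \<Longrightarrow> \<xi> \<in> sections atlas K \<Longrightarrow>
      bracket \<alpha> \<xi> \<in> sections atlas K"

definition abelian_bundle ::
    "('m, 'e::finite_dim_normed) chart set \<Rightarrow> ('m, 'a) section_bracket \<Rightarrow>
     ('m, 'a::real_vector, 'g::finite_dim_normed) vbundle \<Rightarrow> bool" where
  "abelian_bundle atlas bracket K \<longleftrightarrow>
     (\<forall>\<xi>\<in>sections atlas K. \<forall>\<eta>\<in>sections atlas K. bracket \<xi> \<eta> = 0)"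

text \<open>The representation \<open>\<nabla>\<^sup>A\<close> of \<open>A\<close> on the bundle of ideals:\<close>

definition ideal_rep :: "('m, 'a) section_bracket \<Rightarrow> ('m \<Rightarrow> 'a) \<Rightarrow> ('m \<Rightarrow> 'a) \<Rightarrow> 'm \<Rightarrow> 'a" where
  "ideal_rep bracket \<alpha> \<xi> = bracket \<alpha> \<xi>"

text \<open>The conditions \<open>\<nabla>\<^sup>A\<^sub>\<alpha> = \<nabla>\<^bsub>\<rho>(\<alpha>)\<^esub>\<close> and \<open>R(\<rho>(\<alpha>), X) = 0\<close>, imposed for all sections \<open>\<alpha>\<close> of \<open>A\<close> and
  vector fields \<open>X\<close>. Both are linear over the smooth functions in \<open>\<alpha>\<close> and \<open>X\<close>, so this amounts to
  imposing them for all elements \<open>\<alpha>\<close> of \<open>A\<close> and all tangent vectors \<open>X\<close>.\<close>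

definition A_invariant ::
    "('m, 'e::finite_dim_normed) chart set \<Rightarrow>
     ('m, 'a::real_vector, 'f::finite_dim_normed) vbundle \<Rightarrow>
     ('m \<Rightarrow> 'a \<Rightarrow> ('m, 'e) tvec) \<Rightarrow> ('m, 'a) section_bracket \<Rightarrow>
     ('m, 'a, 'g::finite_dim_normed) vbundle \<Rightarrow> ('m, 'e, 'a) connection \<Rightarrow> bool" where
  "A_invariant atlas A anchor bracket K nabla \<longleftrightarrow>
     linear_connection atlas K nabla \<and>
     (\<forall>\<alpha>\<in>sections atlas A. \<forall>\<xi>\<in>sections atlas K.
        ideal_rep bracket \<alpha> \<xi> = nabla (apply_map anchor \<alpha>) \<xi>) \<and>
     (\<forall>\<alpha>\<in>sections atlas A. \<forall>X\<in>vector_fields atlas. \<forall>\<xi>\<in>sections atlas K.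
        curvature atlas nabla (apply_map anchor \<alpha>) X \<xi> = 0)"


section \<open>IM connections\<close>

text \<open>\<open>(L\<^sup>A\<^sub>\<alpha> \<gamma>)(X)\<close>:\<close>

definition lie_derivative ::
    "('m, 'e::finite_dim_normed) chart set \<Rightarrow> ('m \<Rightarrow> 'a \<Rightarrow> ('m, 'e) tvec) \<Rightarrow>
     ('m, 'a::real_vector) section_bracket \<Rightarrow> ('m \<Rightarrow> 'a) \<Rightarrow>
     ('m \<Rightarrow> ('m, 'e) tvec \<Rightarrow> 'a) \<Rightarrow> ('m \<Rightarrow> ('m, 'e) tvec) \<Rightarrow> 'm \<Rightarrow> 'a" where
  "lie_derivative atlas anchor bracket \<alpha> \<gamma> X =
     bracket \<alpha> (apply_map \<gamma> X) - apply_map \<gamma> (vf_bracket atlas (apply_map anchor \<alpha>) X)"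

text \<open>Identities between one-forms are required on tangent vectors or on vector fields only.\<close>

locale IM_connection = bundle_of_ideals atlas A anchor bracket K
  for atlas :: "('m, 'e::finite_dim_normed) chart set"
    and A :: "('m, 'a::real_vector, 'f::finite_dim_normed) vbundle"
    and anchor :: "'m \<Rightarrow> 'a \<Rightarrow> ('m, 'e) tvec"
    and bracket :: "('m, 'a) section_bracket"
    and K :: "('m, 'a, 'g::finite_dim_normed) vbundle" +
  fixes C :: "('m \<Rightarrow> 'a) \<Rightarrow> 'm \<Rightarrow> ('m, 'e) tvec \<Rightarrow> 'a"
    and v :: "'m \<Rightarrow> 'a \<Rightarrow> 'a"
  assumes C_form: "\<alpha> \<in> sections atlas A \<Longrightarrow> C \<alpha> \<in> one_forms atlas K"
    and C_add:
      "\<alpha> \<in> sections atlas A \<Longrightarrow> \<beta> \<in> sections atlas A \<Longrightarrow> w \<in> tangent_space atlas p \<Longrightarrow>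
       C (\<alpha> + \<beta>) p w = C \<alpha> p w + C \<beta> p w"
    and C_scaleR:
      "\<alpha> \<in> sections atlas A \<Longrightarrow> w \<in> tangent_space atlas p \<Longrightarrow>
       C (r *\<^sub>R \<alpha>) p w = r *\<^sub>R C \<alpha> p w"
    and v_map: "bundle_map atlas A K v"
    and v_ideal: "x \<in> fibre K p \<Longrightarrow> v p x = x"
    and C_leibniz:
      "\<alpha> \<in> sections atlas A \<Longrightarrow> f \<in> smooth_functions atlas \<Longrightarrow> w \<in> tangent_space atlas p \<Longrightarrow>
       C (fun_scale f \<alpha>) p w = f p *\<^sub>R C \<alpha> p w + differential atlas f p w *\<^sub>R v p (\<alpha> p)"
    and C_bracket:
      "\<alpha> \<in> sections atlas A \<Longrightarrow> \<beta> \<in> sections atlas A \<Longrightarrow> X \<in> vector_fields atlas \<Longrightarrow>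
       apply_map (C (bracket \<alpha> \<beta>)) X =
         lie_derivative atlas anchor bracket \<alpha> (C \<beta>) X -
         lie_derivative atlas anchor bracket \<beta> (C \<alpha>) X"
    and v_bracket:
      "\<alpha> \<in> sections atlas A \<Longrightarrow> \<beta> \<in> sections atlas A \<Longrightarrow>
       apply_map v (bracket \<alpha> \<beta>) =
         bracket \<alpha> (apply_map v \<beta>) - apply_map (C \<alpha>) (apply_map anchor \<beta>)"

text \<open>The connection \<open>\<nabla>\<^sub>X \<xi> = C(\<xi>)(X)\<close> on the bundle of ideals, i.e. the restriction of \<open>C\<close> to
  sections \<open>\<xi>\<close> of the latter:\<close>

definition induced_connection ::
    "(('m \<Rightarrow> 'a) \<Rightarrow> 'm \<Rightarrow> ('m, 'e) tvec \<Rightarrow> 'a) \<Rightarrow> ('m, 'e, 'a) connection" where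
  "induced_connection C X \<xi> = apply_map (C \<xi>) X"

end

theory Submission
  imports Defs
begin

text \<open>For \<open>\<xi>\<close> in \<open>\<Gamma>(\<kk>)\<close> the anchor vanishes, so an \<open>A\<close>-invariant \<open>\<nabla>\<close> gives
  \<open>[\<xi>, \<eta>] = \<nabla>\<^bsub>\<rho>(\<xi>)\<^esub> \<eta> = 0\<close>. Conversely, let \<open>\<kk>\<close> be abelian. Evaluating the second IM equation on
  \<open>[\<xi>, \<alpha>]\<close>, where \<open>v\<close> acts trivially, the term \<open>[\<xi>, v \<alpha>]\<close> disappears and what remains is
  \<open>[\<alpha>, \<xi>] = \<C>(\<xi>)(\<rho>(\<alpha>))\<close>. Hence \<open>R(\<rho>(\<alpha>), X) \<xi> = (\<L>\<^sub>\<alpha> \<C>(\<xi>) - \<C>[\<alpha>, \<xi>])(X)\<close>, and the first IM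
  equation identifies this with \<open>(\<L>\<^sub>\<xi> \<C>(\<alpha>))(X) = [\<xi>, \<C>(\<alpha>)(X)] - \<C>(\<alpha>)[\<rho>(\<xi>), X] = 0\<close>.
  The analytic input is that bundle maps send smooth sections to smooth sections, by the chain
  rule.\<close>

section \<open>Coordinates on finite-dimensional normed spaces\<close>

text \<open>Induction on the basis. A new vector \<open>a\<close> has positive distance from
  \<open>span B\<close>, because the bound already known for \<open>B\<close> together with
  completeness of the reals makes \<open>span B\<close> closed. That distance controls the
  coefficient of \<open>a\<close>, and the triangle inequality then controls the others. This is
  what makes coordinates continuous when only a finite spanning set is given.\<close>

lemma coefficients_bounded_by_norm:
  fixes B :: "'a::real_normed_vector set"
  assumes "finite B" "independent B"
  shows "\<exists>K\<ge>0. \<forall>c. \<forall>b\<in>B. \<bar>c b\<bar> \<le> K * norm (\<Sum>b\<in>B. c b *\<^sub>R b)"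
  using assms
proof (induction B rule: finite_induct)
  case empty
  then show ?case by auto
next
  case (insert a B)
  have ind: "independent B" and a: "a \<notin> span B"
    using insert.prems insert.hyps by (auto simp: independent_insert split: if_splits)
  obtain K where K0: "K \<ge> 0"
    and K: "\<And>c b. b \<in> B \<Longrightarrow> \<bar>c b\<bar> \<le> K * norm (\<Sum>b\<in>B. c b *\<^sub>R b)"
    using insert.IH[OF ind] by blast
  \<comment> \<open>If no such \<open>d\<close> existed, elements \<open>s n\<close> of the span
    would converge to \<open>- a\<close>.\<close>
  have "\<exists>d>0. \<forall>s\<in>span B. d \<le> norm (a + s)"
  proof (rule ccontr)
    assume "\<not> ?thesis"
    then have "\<forall>n. \<exists>s\<in>span B. norm (a + s) < inverse (real (Suc n))"
      by (meson inverse_positive_iff_positive not_le of_nat_0_less_iff zero_less_Suc)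
    then obtain s where s: "\<And>n. s n \<in> span B" and small: "\<And>n. norm (a + s n) < inverse (real (Suc n))"
      by metis
    have "\<forall>n. \<exists>c. s n = (\<Sum>b\<in>B. c b *\<^sub>R b)"
      using s span_finite[OF insert.hyps(1)] by auto
    then obtain c where c: "\<And>n. s n = (\<Sum>b\<in>B. c n b *\<^sub>R b)"
      by metis
    have "(\<lambda>n. a + s n) \<longlonglongrightarrow> 0"
      by (rule Lim_null_comparison[OF always_eventually LIMSEQ_inverse_real_of_nat])
        (intro allI less_imp_le small)
    then have lim: "s \<longlonglongrightarrow> - a"
      using tendsto_add[of "\<lambda>n. a + s n" 0 sequentially "\<lambda>n. - a" "- a"] by simp
    then have cau: "Cauchy s"
      by (rule LIMSEQ_imp_Cauchy)
    \<comment> \<open>The induction bound applied to differences makes each coefficient sequence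
      Cauchy. Passing to the limit coefficient by coefficient keeps the limit \<open>- a\<close>
      inside \<open>span B\<close>, contradicting independence.\<close>
    have "convergent (\<lambda>n. c n b)" if "b \<in> B" for b
    proof -
      have *: "\<bar>c m b - c n b\<bar> \<le> K * norm (s m - s n)" for m n
        using K[OF that, of "\<lambda>b. c m b - c n b"]
        by (simp add: c scaleR_left_diff_distrib sum_subtractf)
      have "Cauchy (\<lambda>n. c n b)"
      proof (rule CauchyI)
        fix e :: real
        assume "e > 0"
        \<comment> \<open>Dividing by \<open>K + 1\<close> keeps the quotient meaningful when
          \<open>K = 0\<close>.\<close>
        then have "e / (K + 1) > 0"
          using K0 by simp
        then obtain N where N: "\<And>m n. m \<ge> N \<Longrightarrow> n \<ge> N \<Longrightarrow> norm (s m - s n) < e / (K + 1)"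
          using CauchyD[OF cau] by blast
        have "norm (c m b - c n b) < e" if "m \<ge> N" "n \<ge> N" for m n
        proof -
          have "\<bar>c m b - c n b\<bar> \<le> (K + 1) * norm (s m - s n)"
            using *[of m n] by (simp add: distrib_right add_increasing2)
          also have "\<dots> < (K + 1) * (e / (K + 1))"
            using K0 N[OF that] by (intro mult_strict_left_mono) auto
          finally show ?thesis
            using K0 by simp
        qed
        then show "\<exists>N. \<forall>m\<ge>N. \<forall>n\<ge>N. norm (c m b - c n b) < e"
          by blast
      qed
      then show ?thesis
        by (simp add: Cauchy_convergent_iff)
    qed
    then obtain l where l: "\<And>b. b \<in> B \<Longrightarrow> (\<lambda>n. c n b) \<longlonglongrightarrow> l b"
      unfolding convergent_def by metis
    have "s \<longlonglongrightarrow> (\<Sum>b\<in>B. l b *\<^sub>R b)"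
      unfolding c by (intro tendsto_sum tendsto_scaleR l tendsto_const)
    then have "- a = (\<Sum>b\<in>B. l b *\<^sub>R b)"
      using lim LIMSEQ_unique by blast
    moreover have "(\<Sum>b\<in>B. l b *\<^sub>R b) \<in> span B"
      by (intro span_sum span_scale span_base)
    ultimately have "- (- a) \<in> span B"
      by (metis span_neg)
    then show False
      using a by simp
  qed
  then obtain d where d: "d > 0" and dist: "\<And>s. s \<in> span B \<Longrightarrow> d \<le> norm (a + s)"
    by blast
  \<comment> \<open>The first summand bounds the coefficient of \<open>a\<close>. The second bounds
    those over \<open>B\<close>: \<open>K\<close> times the norm of their sum, which is at most
    \<open>1 + norm a / d\<close> times the norm of the whole.\<close>
  let ?K = "1 / d + K * (1 + norm a / d)"
  have "\<bar>c b\<bar> \<le> ?K * norm (\<Sum>b\<in>insert a B. c b *\<^sub>R b)" if b: "b \<in> insert a B" for c b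
  proof -
    let ?s = "\<Sum>b\<in>B. c b *\<^sub>R b"
    let ?N = "norm (c a *\<^sub>R a + ?s)"
    have s: "?s \<in> span B"
      by (intro span_sum span_scale span_base)
    have ca: "\<bar>c a\<bar> * d \<le> ?N"
    proof (cases "c a = 0")
      case False
      have "\<bar>c a\<bar> * d \<le> \<bar>c a\<bar> * norm (a + inverse (c a) *\<^sub>R ?s)"
        using s by (intro mult_left_mono dist span_scale) auto
      also have "\<dots> = norm (c a *\<^sub>R (a + inverse (c a) *\<^sub>R ?s))"
        by simp
      also have "c a *\<^sub>R (a + inverse (c a) *\<^sub>R ?s) = c a *\<^sub>R a + ?s"
        using False by (simp add: scaleR_add_right)
      finally show ?thesis .
    qed auto
    then have ca': "\<bar>c a\<bar> \<le> 1 / d * ?N"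
      using d by (simp add: field_simps)
    have "norm ?s \<le> ?N + norm (c a *\<^sub>R a)"
      using norm_triangle_ineq4[of "c a *\<^sub>R a + ?s" "c a *\<^sub>R a"] by simp
    also have "\<dots> \<le> ?N + (1 / d * ?N) * norm a"
      using mult_right_mono[OF ca' norm_ge_zero[of a]] by simp
    finally have ns: "norm ?s \<le> (1 + norm a / d) * ?N"
      by (simp add: algebra_simps)
    have "\<bar>c b\<bar> \<le> ?K * ?N"
    proof (cases "b = a")
      case True
      have "0 \<le> K * (1 + norm a / d) * ?N"
        using K0 d by simp
      then show ?thesis
        using ca' True by (simp add: distrib_right)
    next
      case False
      then have "\<bar>c b\<bar> \<le> K * norm ?s"
        using b K by blast
      also have "\<dots> \<le> K * ((1 + norm a / d) * ?N)"
        using K0 ns by (rule mult_left_mono[rotated])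
      finally have 1: "\<bar>c b\<bar> \<le> K * (1 + norm a / d) * ?N"
        by (simp only: mult.assoc)
      have "0 \<le> 1 / d * ?N"
        using d by simp
      then show ?thesis
        using 1 by (simp only: distrib_right)
    qed
    then show ?thesis
      using insert.hyps by simp
  qed
  moreover have "?K \<ge> 0"
    using K0 d by simp
  ultimately show ?case
    by blast
qed

text \<open>A maximal independent subset of a finite spanning set is a basis, and the preceding
  bound makes its coordinate functionals continuous. The chain rule below expands directions in this
  basis.\<close>

lemma finite_dim_coordinates:
  obtains B :: "'a::finite_dim_normed set" and coord
  where "finite B" "\<And>b. b \<in> B \<Longrightarrow> bounded_linear (coord b)"
    "\<And>x. x = (\<Sum>b\<in>B. coord b x *\<^sub>R b)"
proof -
  obtain S :: "'a set" where S: "finite S" "\<And>x. \<exists>c. x = (\<Sum>b\<in>S. c b *\<^sub>R b)"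
    using finite_spanning_set by blast
  have spanS: "span S = UNIV"
    using S by (auto simp: span_finite)
  obtain B where B: "B \<subseteq> S" "independent B" "S \<subseteq> span B"
    using maximal_independent_subset by metis
  have fin: "finite B"
    using B(1) S(1) finite_subset by blast
  have span: "span B = UNIV"
    using B(3) spanS span_mono[of S "span B"] by (auto simp: span_span)
  have sum: "x = (\<Sum>b\<in>B. representation B x b *\<^sub>R b)" for x
    using sum_representation_eq[OF B(2) _ fin order_refl, of x] span by simp
  obtain K where K: "\<And>c b. b \<in> B \<Longrightarrow> \<bar>c b\<bar> \<le> K * norm (\<Sum>b\<in>B. c b *\<^sub>R b)"
    using coefficients_bounded_by_norm[OF fin B(2)] by blast
  have "bounded_linear (\<lambda>x. representation B x b)" if "b \<in> B" for b
  proof (rule bounded_linear_intro)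
    show "norm (representation B x b) \<le> norm x * K" for x
      using K[OF that, of "representation B x"] by (simp add: mult.commute flip: sum)
  qed (use span in \<open>simp_all add: representation_add representation_scale B(2)\<close>)
  then show ?thesis
    using that[OF fin, of "\<lambda>b x. representation B x b"] sum by blast
qed

text \<open>Local representatives of fibre maps live on a product of base coordinates and model
  fibre; composing with them requires this product to be an admissible model space.\<close>

instance prod :: (finite_dim_normed, finite_dim_normed) finite_dim_normed
proof
  obtain B :: "'a set" and f where B: "finite B" "\<And>x. x = (\<Sum>b\<in>B. f b x *\<^sub>R b)"
    using finite_dim_coordinates[where 'a='a] by metis
  obtain D :: "'b set" and g where D: "finite D" "\<And>y. y = (\<Sum>d\<in>D. g d y *\<^sub>R d)"
    using finite_dim_coordinates[where 'a='b] by metis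
  let ?S = "B \<times> {0} \<union> {0} \<times> D"
  have "z \<in> span ?S" for z :: "'a \<times> 'b"
  proof -
    have "z = (fst z, 0) + (0, snd z)"
      by simp
    also have "(fst z, 0) = (\<Sum>b\<in>B. f b (fst z) *\<^sub>R (b, 0))"
      by (subst B(2)[of "fst z"]) (simp add: prod_eq_iff fst_sum snd_sum)
    also have "(0, snd z) = (\<Sum>d\<in>D. g d (snd z) *\<^sub>R (0, d))"
      by (subst D(2)[of "snd z"]) (simp add: prod_eq_iff fst_sum snd_sum)
    also have "(\<Sum>b\<in>B. f b (fst z) *\<^sub>R (b, 0)) + (\<Sum>d\<in>D. g d (snd z) *\<^sub>R (0, d)) \<in> span ?S"
      by (intro span_add span_sum span_scale span_base) auto
    finally show ?thesis .
  qed
  moreover have fin: "finite ?S"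
    using B D by simp
  ultimately have "\<forall>z. \<exists>c. z = (\<Sum>b\<in>?S. c b *\<^sub>R b)"
    using span_finite[OF fin] by (auto simp: image_iff)
  then show "\<exists>S::('a \<times> 'b) set. finite S \<and> (\<forall>z. \<exists>c. z = (\<Sum>b\<in>S. c b *\<^sub>R b))"
    using fin by blast
qed

section \<open>Calculus of smooth maps\<close>

text \<open>\<open>Ck_on\<close> refers to derivatives taken in the full space. On an open set
  agreement at all points is agreement near each point, so the derivatives agree as well and the
  induction continues with them.\<close>

lemma Ck_on_cong:
  assumes "open S" "Ck_on k S f" "\<And>x. x \<in> S \<Longrightarrow> f x = g x"
  shows "Ck_on k S g"
  using assms(2,3)
proof (induction k arbitrary: f g)
  case 0
  then show ?case by (simp cong: continuous_on_cong)
next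
  case (Suc k)
  have D: "(g has_derivative frechet_derivative f (at x)) (at x)" if "x \<in> S" for x
    using Suc.prems that assms(1)
    by (auto simp: frechet_derivative_works intro: has_derivative_transform_within_open)
  have "Ck_on k S (\<lambda>x. frechet_derivative g (at x) u)" for u
    using Suc.prems Suc.IH[of "\<lambda>x. frechet_derivative f (at x) u"] frechet_derivative_at[OF D]
    by auto
  then show ?case
    using D by (auto simp: differentiable_def)
qed

text \<open>Derivatives are unique, so an explicit derivative \<open>f'\<close> may replace the
  choice-based \<open>frechet_derivative\<close> on the open set. All closure properties below enter
  through this rule.\<close>

lemma Ck_on_SucI:
  assumes "open S" "\<And>x. x \<in> S \<Longrightarrow> (f has_derivative f' x) (at x)"
    and "\<And>u. Ck_on k S (\<lambda>x. f' x u)"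
  shows "Ck_on (Suc k) S f"
proof -
  have "f' x = frechet_derivative f (at x)" if "x \<in> S" for x
    using frechet_derivative_at[OF assms(2)[OF that]] .
  then have "Ck_on k S (\<lambda>x. frechet_derivative f (at x) u)" for u
    using Ck_on_cong[OF assms(1) assms(3)[of u]] by simp
  then show ?thesis
    using assms(2) by (auto simp: differentiable_def)
qed

lemma Ck_on_Suc_has_derivative:
  "Ck_on (Suc k) S f \<Longrightarrow> x \<in> S \<Longrightarrow> (f has_derivative frechet_derivative f (at x)) (at x)"
  by (simp add: frechet_derivative_works)

text \<open>The base case is continuity of differentiable maps. The rule serves product and chain
  rules, whose derivatives still contain undifferentiated factors.\<close>

lemma Ck_on_Suc_imp_Ck_on: "Ck_on (Suc k) S f \<Longrightarrow> Ck_on k S f"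
proof (induction k arbitrary: f)
  case 0
  then show ?case
    by (auto intro!: continuous_at_imp_continuous_on differentiable_imp_continuous_within)
next
  case (Suc k)
  have "Ck_on k S (\<lambda>x. frechet_derivative f (at x) u)" for u
    using Suc.prems by (intro Suc.IH) simp
  then show ?case
    using Suc.prems by simp
qed

lemma Ck_on_locally:
  assumes "\<And>x. x \<in> S \<Longrightarrow> \<exists>T. open T \<and> x \<in> T \<and> Ck_on k T f"
  shows "Ck_on k S f"
  using assms
proof (induction k arbitrary: f)
  case 0
  then show ?case
    by (metis Ck_on.simps(1) continuous_at_imp_continuous_on continuous_on_eq_continuous_at)
next
  case (Suc k)
  have "Ck_on k S (\<lambda>x. frechet_derivative f (at x) u)" for u
    using Suc.prems by (intro Suc.IH) fastforce
  moreover have "f differentiable (at x)" if "x \<in> S" for x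
    using Suc.prems[OF that] by auto
  ultimately show ?case by simp
qed

section \<open>Closure of C^k maps under linear operations, products and composition\<close>

lemma Ck_on_const: "open S \<Longrightarrow> Ck_on k S (\<lambda>x. c)"
proof (induction k arbitrary: c)
  case (Suc k)
  then show ?case
    by (intro Ck_on_SucI[where f' = "\<lambda>x u. 0"]) auto
qed simp

lemma Ck_on_ident: "open S \<Longrightarrow> Ck_on k S (\<lambda>x. x)"
proof (cases k)
  case (Suc n)
  assume "open S"
  then show ?thesis
    unfolding Suc by (intro Ck_on_SucI[where f' = "\<lambda>x u. u"]) (auto intro: Ck_on_const)
qed simp

lemma Ck_on_bounded_linear:
  assumes "open S" "bounded_linear L" "Ck_on k S f"
  shows "Ck_on k S (\<lambda>x. L (f x))"
  using assms(3)
proof (induction k arbitrary: f)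
  case 0
  then show ?case
    using assms(2) by (simp add: bounded_linear.continuous_on)
next
  case (Suc k)
  show ?case
  proof (rule Ck_on_SucI[OF assms(1)])
    show "((\<lambda>x. L (f x)) has_derivative (\<lambda>u. L (frechet_derivative f (at x) u))) (at x)"
      if "x \<in> S" for x
      using bounded_linear.has_derivative[OF assms(2) Ck_on_Suc_has_derivative[OF Suc.prems that]] .
    show "Ck_on k S (\<lambda>x. L (frechet_derivative f (at x) u))" for u
      using Suc.prems by (intro Suc.IH) simp
  qed
qed

lemma Ck_on_add:
  assumes "open S" "Ck_on k S f" "Ck_on k S g"
  shows "Ck_on k S (\<lambda>x. f x + g x)"
  using assms(2,3)
proof (induction k arbitrary: f g)
  case 0
  then show ?case by (simp add: continuous_on_add)
next
  case (Suc k)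
  show ?case
  proof (rule Ck_on_SucI[OF assms(1)])
    show "((\<lambda>x. f x + g x) has_derivative
        (\<lambda>u. frechet_derivative f (at x) u + frechet_derivative g (at x) u)) (at x)"
      if "x \<in> S" for x
      using Suc.prems that by (intro has_derivative_add Ck_on_Suc_has_derivative)
    show "Ck_on k S (\<lambda>x. frechet_derivative f (at x) u + frechet_derivative g (at x) u)" for u
      using Suc.prems by (intro Suc.IH) simp_all
  qed
qed

lemma Ck_on_sum:
  assumes "open S" "finite B" "\<And>b. b \<in> B \<Longrightarrow> Ck_on k S (f b)"
  shows "Ck_on k S (\<lambda>x. \<Sum>b\<in>B. f b x)"
  using assms(2,3)
  by (induction B rule: finite_induct) (simp_all add: Ck_on_const Ck_on_add assms(1))

lemma Ck_on_scaleR: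
  assumes "open S" "Ck_on k S f" "Ck_on k S g"
  shows "Ck_on k S (\<lambda>x. f x *\<^sub>R g x)"
  using assms(2,3)
proof (induction k arbitrary: f g)
  case 0
  then show ?case by (simp add: continuous_on_scaleR)
next
  case (Suc k)
  show ?case
  proof (rule Ck_on_SucI[OF assms(1)])
    show "((\<lambda>x. f x *\<^sub>R g x) has_derivative
        (\<lambda>u. f x *\<^sub>R frechet_derivative g (at x) u + frechet_derivative f (at x) u *\<^sub>R g x)) (at x)"
      if "x \<in> S" for x
      using Suc.prems that by (intro has_derivative_scaleR Ck_on_Suc_has_derivative)
    show "Ck_on k S (\<lambda>x. f x *\<^sub>R frechet_derivative g (at x) u +
        frechet_derivative f (at x) u *\<^sub>R g x)" for u
      using Suc.prems Suc.prems[THEN Ck_on_Suc_imp_Ck_on]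
      by (intro Ck_on_add[OF assms(1)] Suc.IH) simp_all
  qed
qed

lemma Ck_on_Pair:
  assumes "open S" "Ck_on k S f" "Ck_on k S g"
  shows "Ck_on k S (\<lambda>x. (f x, g x))"
  using assms(2,3)
proof (induction k arbitrary: f g)
  case 0
  then show ?case by (simp add: continuous_on_Pair)
next
  case (Suc k)
  show ?case
  proof (rule Ck_on_SucI[OF assms(1)])
    show "((\<lambda>x. (f x, g x)) has_derivative
        (\<lambda>u. (frechet_derivative f (at x) u, frechet_derivative g (at x) u))) (at x)"
      if "x \<in> S" for x
      using Suc.prems that by (intro has_derivative_Pair Ck_on_Suc_has_derivative)
    show "Ck_on k S (\<lambda>x. (frechet_derivative f (at x) u, frechet_derivative g (at x) u))" for u
      using Suc.prems by (intro Suc.IH) simp_all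
  qed
qed

text \<open>In the chain rule the derivative of \<open>g\<close> is taken in the direction of the
  derivative of \<open>h\<close>, which varies with \<open>x\<close>, whereas \<open>Ck_on\<close>
  speaks of fixed directions only. Expanding the varying direction in a basis of the
  finite-dimensional middle space turns the derivative into a finite sum of coordinate functions
  times partial derivatives of \<open>g\<close> along \<open>h\<close>.\<close>

lemma Ck_on_compose:
  fixes h :: "'a::real_normed_vector \<Rightarrow> 'b::finite_dim_normed"
    and g :: "'b \<Rightarrow> 'c::real_normed_vector"
  assumes "open S" "h ` S \<subseteq> T" "Ck_on k T g" "Ck_on k S h"
  shows "Ck_on k S (\<lambda>x. g (h x))"
  using assms(3,4)
proof (induction k arbitrary: g)
  case 0
  then show ?case
    using assms(2) unfolding Ck_on.simps by (rule continuous_on_compose2)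
next
  case (Suc k)
  obtain B :: "'b set" and coord where B: "finite B" "\<And>b. b \<in> B \<Longrightarrow> bounded_linear (coord b)"
    and repr: "\<And>y. y = (\<Sum>b\<in>B. coord b y *\<^sub>R b)"
    by (rule finite_dim_coordinates) blast
  let ?g = "\<lambda>b y. frechet_derivative g (at y) b"
  let ?h = "\<lambda>u x. frechet_derivative h (at x) u"
  show ?case
  proof (rule Ck_on_SucI[OF assms(1)])
    fix x
    assume x: "x \<in> S"
    then have dg: "(g has_derivative frechet_derivative g (at (h x))) (at (h x))"
      using assms(2) by (intro Ck_on_Suc_has_derivative[OF Suc.prems(1)]) auto
    have D: "((\<lambda>x. g (h x)) has_derivative (\<lambda>u. ?g (?h u x) (h x))) (at x)"
      by (rule has_derivative_compose[OF Ck_on_Suc_has_derivative[OF Suc.prems(2) x] dg])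
    have "?g y (h x) = (\<Sum>b\<in>B. coord b y *\<^sub>R ?g b (h x))" for y
    proof -
      have "?g y (h x) = ?g (\<Sum>b\<in>B. coord b y *\<^sub>R b) (h x)"
        by (rule arg_cong[OF repr])
      then show ?thesis
        by (simp only: linear_sum[OF has_derivative_linear[OF dg]]
            linear_scale[OF has_derivative_linear[OF dg]])
    qed
    then show "((\<lambda>x. g (h x)) has_derivative
        (\<lambda>u. \<Sum>b\<in>B. coord b (?h u x) *\<^sub>R ?g b (h x))) (at x)"
      by (intro has_derivative_eq_rhs[OF D] ext)
  next
    fix u
    \<comment> \<open>The induction generalises over \<open>g\<close>, so its hypothesis applies to
      the partial derivatives of \<open>g\<close>, composed with \<open>h\<close> taken at the lower
      order.\<close>
    have "Ck_on k S (\<lambda>x. ?g b (h x))" for b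
      using Suc.prems Suc.prems(2)[THEN Ck_on_Suc_imp_Ck_on] by (intro Suc.IH) simp_all
    moreover have "Ck_on k S (\<lambda>x. coord b (?h u x))" if "b \<in> B" for b
      using Suc.prems(2) by (intro Ck_on_bounded_linear[OF assms(1) B(2)[OF that]]) simp
    ultimately show "Ck_on k S (\<lambda>x. \<Sum>b\<in>B. coord b (?h u x) *\<^sub>R ?g b (h x))"
      by (intro Ck_on_sum Ck_on_scaleR assms(1) B(1))
  qed
qed

section \<open>From C^k maps of every order to smooth maps\<close>

lemma smooth_on_locally:
  assumes "\<And>x. x \<in> S \<Longrightarrow> \<exists>T. open T \<and> x \<in> T \<and> smooth_on T f"
  shows "smooth_on S f"
  unfolding smooth_on_def
proof (intro allI Ck_on_locally)
  fix k x
  assume "x \<in> S"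
  then show "\<exists>T. open T \<and> x \<in> T \<and> Ck_on k T f"
    using assms unfolding smooth_on_def by blast
qed

lemma smooth_on_cong:
  "open S \<Longrightarrow> smooth_on S f \<Longrightarrow> (\<And>x. x \<in> S \<Longrightarrow> f x = g x) \<Longrightarrow> smooth_on S g"
  unfolding smooth_on_def by (metis Ck_on_cong)

lemma Ck_on_subset: "T \<subseteq> S \<Longrightarrow> Ck_on k S f \<Longrightarrow> Ck_on k T f"
proof (induction k arbitrary: f)
  case 0
  then show ?case
    by (simp add: continuous_on_subset[of S])
qed auto

lemma smooth_on_subset: "T \<subseteq> S \<Longrightarrow> smooth_on S f \<Longrightarrow> smooth_on T f"
  unfolding smooth_on_def by (simp add: Ck_on_subset[of T S])

lemma smooth_on_differentiable: "smooth_on S f \<Longrightarrow> x \<in> S \<Longrightarrow> f differentiable (at x)"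
  unfolding smooth_on_def by (auto dest: spec[of _ "Suc 0"])

text \<open>This is composition with the graph map of \<open>h\<close>. It fits a fibre map, smooth
  jointly in base point and fibre vector, evaluated on the local representative \<open>h\<close> of
  a section.\<close>

lemma smooth_on_graph_compose:
  fixes g :: "'a::finite_dim_normed \<times> 'b::finite_dim_normed \<Rightarrow> 'c::real_normed_vector"
  assumes "open S" "smooth_on (S \<times> UNIV) g" "smooth_on S h"
  shows "smooth_on S (\<lambda>x. g (x, h x))"
  unfolding smooth_on_def
proof
  fix k
  have g: "Ck_on k (S \<times> UNIV) g" and h: "Ck_on k S h"
    using assms unfolding smooth_on_def by blast+
  have "(\<lambda>x. (x, h x)) ` S \<subseteq> S \<times> UNIV"
    by auto
  then show "Ck_on k S (\<lambda>x. g (x, h x))"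
    using g Ck_on_Pair[OF assms(1) Ck_on_ident[OF assms(1)] h] by (rule Ck_on_compose[OF assms(1)])
qed

section \<open>Bundle maps and sections\<close>

lemma tangent_bundle_open_triv:
  assumes "smooth_atlas atlas" "(U, \<tau>) \<in> trivs (tangent_bundle atlas)"
  shows "openin (atlas_topology atlas) U"
proof -
  obtain \<phi> where "(U, \<phi>) \<in> atlas"
    using assms(2) by (auto simp: tangent_bundle_def)
  moreover have "open (\<psi> ` (V \<inter> U'))" if "(V, \<psi>) \<in> atlas" "(U', \<phi>') \<in> atlas" for V \<psi> U' \<phi>'
    using assms(1) that unfolding smooth_atlas_def by fast
  ultimately show ?thesis
    unfolding openin_atlas_topology[OF assms(1)] by fast
qed

lemma tangent_bundle_trivs_cover:
  assumes "smooth_atlas atlas"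
  shows "(\<Union>(U, \<tau>)\<in>trivs (tangent_bundle atlas). U) = UNIV"
proof -
  have "(\<Union>(U, \<tau>)\<in>trivs (tangent_bundle atlas). U) = (\<Union>(U, \<phi>)\<in>atlas. U)"
    by (simp add: tangent_bundle_def case_prod_beta)
  then show ?thesis
    using assms by (simp add: smooth_atlas_def)
qed

lemma tangent_space_transition:
  assumes "w \<in> tangent_space atlas p" "(U, \<phi>) \<in> atlas" "(V, \<psi>) \<in> atlas" "p \<in> U" "p \<in> V"
  shows "w (V, \<psi>) = frechet_derivative (\<psi> \<circ> inv_into U \<phi>) (at (\<phi> p)) (w (U, \<phi>))"
proof -
  have "\<forall>(U, \<phi>)\<in>atlas. \<forall>(V, \<psi>)\<in>atlas. p \<in> U \<inter> V \<longrightarrow>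
      w (V, \<psi>) = frechet_derivative (\<psi> \<circ> inv_into U \<phi>) (at (\<phi> p)) (w (U, \<phi>))"
    using assms(1) unfolding tangent_space_def by blast
  from bspec[OF this assms(2), unfolded case_prod_conv, THEN bspec, OF assms(3)] show ?thesis
    using assms(4,5) unfolding case_prod_conv by blast
qed

text \<open>The transformation law recovers every coordinate vector at \<open>p\<close> from the one
  in \<open>(U, \<phi>)\<close>; away from charts around \<open>p\<close> the representation is
  fixed to be zero. Hence one coordinate vector determines the tangent vector.\<close>

lemma tangent_bundle_inj_triv:
  assumes "(U, \<tau>) \<in> trivs (tangent_bundle atlas)" "p \<in> U"
  shows "inj_on (\<tau> p) (fibre (tangent_bundle atlas) p)"
proof -
  obtain \<phi> where c: "(U, \<phi>) \<in> atlas" and \<tau>: "\<tau> = (\<lambda>p w. w (U, \<phi>))"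
    using assms(1) by (auto simp: tangent_bundle_def)
  have "w = w'" if w: "w \<in> tangent_space atlas p" "w' \<in> tangent_space atlas p"
    and eq: "w (U, \<phi>) = w' (U, \<phi>)" for w w'
  proof
    fix d
    show "w d = w' d"
    proof (cases "d \<in> atlas \<and> p \<in> fst d")
      case True
      obtain V \<psi> where d: "d = (V, \<psi>)"
        by (cases d)
      have "z d = frechet_derivative (\<psi> \<circ> inv_into U \<phi>) (at (\<phi> p)) (z (U, \<phi>))"
        if "z \<in> tangent_space atlas p" for z
        using tangent_space_transition[OF that c _ assms(2)] True unfolding d by simp
      from this[OF w(1)] this[OF w(2)] show ?thesis
        by (simp only: eq)
    next
      case False
      have "z d = 0" if "z \<in> tangent_space atlas p" for z
        using that False unfolding tangent_space_def by blast
      from this[OF w(1)] this[OF w(2)] show ?thesis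
        by (simp only:)
    qed
  qed
  then show ?thesis
    unfolding \<tau> by (auto simp: tangent_bundle_def intro: inj_onI)
qed

text \<open>Stated without the locale of vector bundles, so that it applies to the tangent bundle on
  either side without having to know that the latter is a vector bundle.\<close>

lemma apply_map_sections:
  fixes E :: "('m, 'a::real_vector, 'f::finite_dim_normed) vbundle"
    and E' :: "('m, 'b::real_vector, 'g::finite_dim_normed) vbundle"
  assumes atlas: "smooth_atlas atlas"
    and cover: "(\<Union>(U, \<tau>)\<in>trivs E. U) = UNIV"
    and opn: "\<And>U \<tau>. (U, \<tau>) \<in> trivs E \<Longrightarrow> openin (atlas_topology atlas) U"
    and inj: "\<And>U \<tau> p. (U, \<tau>) \<in> trivs E \<Longrightarrow> p \<in> U \<Longrightarrow> inj_on (\<tau> p) (fibre E p)"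
    and opn': "\<And>V \<sigma>. (V, \<sigma>) \<in> trivs E' \<Longrightarrow> openin (atlas_topology atlas) V"
    and F: "bundle_map atlas E E' F"
    and s: "s \<in> sections atlas E"
  shows "apply_map F s \<in> sections atlas E'"
proof -
  have fib: "s p \<in> fibre E p" for p
    using s by (simp add: sections_def)
  have "F p (s p) \<in> fibre E' p" for p
    using F fib unfolding bundle_map_def linear_between_def by blast
  moreover have "smooth_map_on atlas V (\<lambda>p. \<sigma> p (F p (s p)))" if V: "(V, \<sigma>) \<in> trivs E'" for V \<sigma>
    unfolding smooth_map_on_def
  proof clarify
    fix W \<phi>
    assume W: "(W, \<phi>) \<in> atlas"
    have inj\<phi>: "inj_on \<phi> W"
      using atlas W by (auto simp: smooth_atlas_def)
    show "smooth_on (\<phi> ` (W \<inter> V)) ((\<lambda>p. \<sigma> p (F p (s p))) \<circ> inv_into W \<phi>)"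
    \<comment> \<open>A trivialisation of the target need not lie over a single trivialisation of
      the source, so smoothness is checked near each point, over the overlap of both domains with
      the chart.\<close>
    proof (rule smooth_on_locally)
      fix x
      assume "x \<in> \<phi> ` (W \<inter> V)"
      then obtain q where q: "q \<in> W" "q \<in> V" "x = \<phi> q"
        by blast
      have "q \<in> (\<Union>(U, \<tau>)\<in>trivs E. U)"
        by (simp only: cover UNIV_I)
      then obtain U \<tau> where U: "(U, \<tau>) \<in> trivs E" "q \<in> U"
        by (elim UN_E) auto
      let ?T = "\<phi> ` (W \<inter> U \<inter> V)"
      have "openin (atlas_topology atlas) (U \<inter> V)" "openin (atlas_topology atlas) U"
        using opn[OF U(1)] opn'[OF V] by auto
      then have opT: "open ?T" "open (\<phi> ` (W \<inter> U))"
        using W unfolding openin_atlas_topology[OF atlas] by (auto simp: Int_assoc)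
      have "smooth_map_on atlas U (\<lambda>p. \<tau> p (s p))"
        using s U(1) unfolding sections_def by fast
      then have "smooth_on (\<phi> ` (W \<inter> U)) ((\<lambda>p. \<tau> p (s p)) \<circ> inv_into W \<phi>)"
        using W unfolding smooth_map_on_def by fast
      then have s_smooth: "smooth_on ?T ((\<lambda>p. \<tau> p (s p)) \<circ> inv_into W \<phi>)"
        by (rule smooth_on_subset[rotated]) blast
      have "smooth_on (?T \<times> UNIV)
          (\<lambda>(x, e). let p = inv_into W \<phi> x in \<sigma> p (F p (inv_into (fibre E p) (\<tau> p) e)))"
        using F U(1) V W unfolding bundle_map_def smooth_fibre_map_def by fast
      from smooth_on_graph_compose[OF opT(1) this s_smooth]
      have "smooth_on ?T (\<lambda>x. let p = inv_into W \<phi> x in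
          \<sigma> p (F p (inv_into (fibre E p) (\<tau> p) (\<tau> p (s p)))))"
        by (simp only: case_prod_conv o_def Let_def)
      \<comment> \<open>Since \<open>s p\<close> lies in the fibre, injectivity of
        \<open>\<tau> p\<close> lets \<open>inv_into\<close> return exactly \<open>s p\<close>;
        injectivity of the chart keeps the base point in \<open>U\<close>.\<close>
      then have "smooth_on ?T ((\<lambda>p. \<sigma> p (F p (s p))) \<circ> inv_into W \<phi>)"
        by (rule smooth_on_cong[OF opT(1)])
          (auto simp: Let_def inv_into_f_f inj\<phi> inv_into_f_f[OF inj[OF U(1)] fib])
      then show "\<exists>T. open T \<and> x \<in> T \<and> smooth_on T ((\<lambda>p. \<sigma> p (F p (s p))) \<circ> inv_into W \<phi>)"
        using opT(1) q U(2) by blast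
    qed
  qed
  ultimately show ?thesis
    by (auto simp: sections_def apply_map_def)
qed

context vector_bundle
begin

lemma smooth_atlas: "smooth_atlas atlas"
  using manifold by (simp add: smooth_manifold_def)

lemma inj_triv: "(U, \<tau>) \<in> trivs E \<Longrightarrow> p \<in> U \<Longrightarrow> inj_on (\<tau> p) (fibre E p)"
  using bij_triv bij_betw_imp_inj_on by blast

lemma apply_map_to_tangent:
  "bundle_map atlas E (tangent_bundle atlas) F \<Longrightarrow> s \<in> sections atlas E \<Longrightarrow>
    apply_map F s \<in> vector_fields atlas"
  using smooth_atlas trivs_cover open_triv inj_triv tangent_bundle_open_triv[OF smooth_atlas]
  by (rule apply_map_sections)

lemma apply_map_from_tangent:
  "\<gamma> \<in> one_forms atlas E \<Longrightarrow> X \<in> vector_fields atlas \<Longrightarrow> apply_map \<gamma> X \<in> sections atlas E"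
  unfolding one_forms_def mem_Collect_eq
  using smooth_atlas tangent_bundle_trivs_cover[OF smooth_atlas]
    tangent_bundle_open_triv[OF smooth_atlas] tangent_bundle_inj_triv open_triv
  by (rule apply_map_sections)

end

lemma apply_map_bundle_map:
  assumes "vector_bundle atlas E" "vector_bundle atlas E'"
    and "bundle_map atlas E E' F" "s \<in> sections atlas E"
  shows "apply_map F s \<in> sections atlas E'"
proof -
  interpret E: vector_bundle atlas E by fact
  interpret E': vector_bundle atlas E' by fact
  show ?thesis
    using E.smooth_atlas E.trivs_cover E.open_triv E.inj_triv E'.open_triv assms(3,4)
    by (rule apply_map_sections)
qed

section \<open>Pointwise rules for sections, one-forms and the bracket of vector fields\<close>

lemma sections_fibre: "s \<in> sections atlas E \<Longrightarrow> s p \<in> fibre E p"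
  by (simp add: sections_def)

lemma vector_field_tangent: "X \<in> vector_fields atlas \<Longrightarrow> X p \<in> tangent_space atlas p"
  using sections_fibre[of X atlas "tangent_bundle atlas"] by (simp add: tangent_bundle_def)

lemma one_form_add:
  "\<gamma> \<in> one_forms atlas E \<Longrightarrow> w \<in> tangent_space atlas p \<Longrightarrow> w' \<in> tangent_space atlas p \<Longrightarrow>
    \<gamma> p (w + w') = \<gamma> p w + \<gamma> p w'"
  by (simp add: one_forms_def bundle_map_def linear_between_def tangent_bundle_def)

lemma one_form_scaleR:
  "\<gamma> \<in> one_forms atlas E \<Longrightarrow> w \<in> tangent_space atlas p \<Longrightarrow> \<gamma> p (r *\<^sub>R w) = r *\<^sub>R \<gamma> p w"
  by (simp add: one_forms_def bundle_map_def linear_between_def tangent_bundle_def)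

lemma one_form_zero:
  "\<gamma> \<in> one_forms atlas E \<Longrightarrow> w \<in> tangent_space atlas p \<Longrightarrow> \<gamma> p 0 = 0"
  using one_form_scaleR[of \<gamma> atlas E w p 0] by simp

text \<open>In a chart one term differentiates the zero map and the other applies the derivative of
  \<open>X\<close> to the zero vector. The latter vanishes by linearity, which
  \<open>frechet_derivative\<close> is known to have once the coordinate representation of
  \<open>X\<close> is differentiable.\<close>

lemma vf_bracket_zero_left:
  fixes atlas :: "('m, 'e::finite_dim_normed) chart set"
  assumes "X \<in> vector_fields atlas"
  shows "vf_bracket atlas 0 X = 0"
proof (intro ext)
  fix p and c :: "('m, 'e) chart"
  obtain U \<phi> where c: "c = (U, \<phi>)"
    by (cases c)
  show "vf_bracket atlas 0 X p c = 0 p c"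
  proof (cases "(U, \<phi>) \<in> atlas \<and> p \<in> U")
    case True
    have "smooth_map_on atlas U (\<lambda>p. X p (U, \<phi>))"
      using assms True by (force simp: sections_def tangent_bundle_def)
    then have "smooth_on (\<phi> ` U) (\<lambda>x. X (inv_into U \<phi> x) (U, \<phi>))"
      using True by (fastforce simp: smooth_map_on_def o_def)
    then have "(\<lambda>x. X (inv_into U \<phi> x) (U, \<phi>)) differentiable (at (\<phi> p))"
      using True smooth_on_differentiable by blast
    then have "linear (frechet_derivative (\<lambda>x. X (inv_into U \<phi> x) (U, \<phi>)) (at (\<phi> p)))"
      by (rule linear_frechet_derivative)
    then show ?thesis
      using True by (simp add: c vf_bracket_def linear_0)
  qed (auto simp: c vf_bracket_def)
qed

section \<open>The connection induced by an IM connection\<close>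

context bundle_of_ideals
begin

lemma vector_bundle_ideals: "vector_bundle atlas K"
  using subbundle by (simp add: vector_subbundle_def)

text \<open>Smoothness in the trivialisations of \<open>K\<close> has to be transferred to those of
  \<open>A\<close>; the inclusion is a bundle map, and bundle maps preserve smooth sections.\<close>

lemma ideal_sections: "\<xi> \<in> sections atlas K \<Longrightarrow> \<xi> \<in> sections atlas A"
  using apply_map_bundle_map[of atlas K A "\<lambda>p a. a" \<xi>] subbundle
  by (simp add: vector_subbundle_def apply_map_def)

lemma anchor_section: "\<alpha> \<in> sections atlas A \<Longrightarrow> apply_map anchor \<alpha> \<in> vector_fields atlas"
  using anchor_map by (rule apply_map_to_tangent)

lemma anchor_ideal_section: "\<xi> \<in> sections atlas K \<Longrightarrow> apply_map anchor \<xi> = 0"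
  by (simp add: apply_map_def fun_eq_iff ker_anchor sections_fibre)

end

context IM_connection
begin

interpretation K: vector_bundle atlas K
  by (rule vector_bundle_ideals)

lemma C_section:
  "\<alpha> \<in> sections atlas A \<Longrightarrow> X \<in> vector_fields atlas \<Longrightarrow> apply_map (C \<alpha>) X \<in> sections atlas K"
  using C_form by (rule K.apply_map_from_tangent)

lemma v_section: "\<alpha> \<in> sections atlas A \<Longrightarrow> apply_map v \<alpha> \<in> sections atlas K"
  using vector_bundle_axioms vector_bundle_ideals v_map by (rule apply_map_bundle_map)

lemma v_ideal_section: "\<xi> \<in> sections atlas K \<Longrightarrow> apply_map v \<xi> = \<xi>"
  by (simp add: apply_map_def fun_eq_iff v_ideal sections_fibre)

text \<open>The field \<open>X\<close> supplies a tangent vector at every point; scaling it by 0 and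
  using linearity of the form gives the value at zero.\<close>

lemma C_zero:
  assumes "\<alpha> \<in> sections atlas A" "X \<in> vector_fields atlas"
  shows "apply_map (C \<alpha>) 0 = 0"
  using one_form_zero[OF C_form[OF assms(1)] vector_field_tangent[OF assms(2)]]
  by (simp add: apply_map_def fun_eq_iff)

text \<open>Linearity in the vector field is that of one-forms. The Leibniz rule for
  \<open>C\<close> becomes that of a connection because \<open>v\<close> is the identity on
  \<kk>.\<close>

lemma linear_connection_induced: "linear_connection atlas K (induced_connection C)"
proof
  fix X \<xi>
  assume X: "X \<in> vector_fields atlas" and \<xi>: "\<xi> \<in> sections atlas K"
  note XA = vector_field_tangent[OF X] and \<xi>A = ideal_sections[OF \<xi>]
  show "induced_connection C X \<xi> \<in> sections atlas K"
    unfolding induced_connection_def by (rule C_section[OF \<xi>A X])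
  show "induced_connection C (X + Y) \<xi> = induced_connection C X \<xi> + induced_connection C Y \<xi>"
    if "Y \<in> vector_fields atlas" for Y
    using one_form_add[OF C_form[OF \<xi>A] XA vector_field_tangent[OF that]]
    by (simp add: induced_connection_def apply_map_def fun_eq_iff)
  show "induced_connection C (fun_scale f X) \<xi> = fun_scale f (induced_connection C X \<xi>)" for f
    using one_form_scaleR[OF C_form[OF \<xi>A] XA]
    by (simp add: induced_connection_def apply_map_def fun_scale_def)
  show "induced_connection C X (\<xi> + \<eta>) = induced_connection C X \<xi> + induced_connection C X \<eta>"
    if "\<eta> \<in> sections atlas K" for \<eta>
    using C_add[OF \<xi>A ideal_sections[OF that] XA]
    by (simp add: induced_connection_def apply_map_def fun_eq_iff)
  show "induced_connection C X (fun_scale f \<xi>) = fun_scale f (induced_connection C X \<xi>) +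
      fun_scale (apply_map (differential atlas f) X) \<xi>" if "f \<in> smooth_functions atlas" for f
    using C_leibniz[OF \<xi>A that XA] v_ideal[OF sections_fibre[OF \<xi>]]
    by (simp add: induced_connection_def apply_map_def fun_scale_def fun_eq_iff)
qed

section \<open>The two directions of the equivalence\<close>

lemma abelian_if_A_invariant:
  assumes "A_invariant atlas A anchor bracket K (induced_connection C)"
  shows "abelian_bundle atlas bracket K"
  unfolding abelian_bundle_def
proof (intro ballI)
  fix \<xi> \<eta>
  assume \<xi>: "\<xi> \<in> sections atlas K" and \<eta>: "\<eta> \<in> sections atlas K"
  have "bracket \<xi> \<eta> = apply_map (C \<eta>) (apply_map anchor \<xi>)"
    using assms ideal_sections[OF \<xi>] \<eta>
    by (simp add: A_invariant_def ideal_rep_def induced_connection_def)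
  then show "bracket \<xi> \<eta> = 0"
    using C_zero[OF ideal_sections[OF \<eta>] anchor_section[OF ideal_sections[OF \<xi>]]]
    by (simp add: anchor_ideal_section[OF \<xi>])
qed

lemma A_invariant_if_abelian:
  assumes "abelian_bundle atlas bracket K"
  shows "A_invariant atlas A anchor bracket K (induced_connection C)"
proof -
  have ab: "bracket \<xi> \<eta> = 0" if "\<xi> \<in> sections atlas K" "\<eta> \<in> sections atlas K" for \<xi> \<eta>
    using assms that by (simp add: abelian_bundle_def)
  have rep: "bracket \<alpha> \<xi> = apply_map (C \<xi>) (apply_map anchor \<alpha>)"
    if \<alpha>: "\<alpha> \<in> sections atlas A" and \<xi>: "\<xi> \<in> sections atlas K" for \<alpha> \<xi>
  proof -
    note \<xi>A = ideal_sections[OF \<xi>]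
    \<comment> \<open>The order of the arguments matters: the second IM equation for
      \<open>bracket \<alpha> \<xi>\<close> is a tautology, while for
      \<open>bracket \<xi> \<alpha>\<close> it contains the bracket of \<xi> with \<open>v\<close>
      of \<alpha>, to which commutativity applies.\<close>
    have skew: "bracket \<xi> \<alpha> = - bracket \<alpha> \<xi>"
      by (rule bracket_skew[OF \<xi>A \<alpha>])
    have "bracket \<xi> \<alpha> p \<in> fibre K p" for p
      using subspace_neg[OF K.subspace_fibre sections_fibre[OF ideal[OF \<alpha> \<xi>]]] by (simp add: skew)
    then have "bracket \<xi> \<alpha> = apply_map v (bracket \<xi> \<alpha>)"
      by (simp add: apply_map_def fun_eq_iff v_ideal)
    also have "\<dots> = - apply_map (C \<xi>) (apply_map anchor \<alpha>)"
      using v_bracket[OF \<xi>A \<alpha>] ab[OF \<xi> v_section[OF \<alpha>]] by simp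
    finally show ?thesis
      by (simp add: skew)
  qed
  have "curvature atlas (induced_connection C) (apply_map anchor \<alpha>) X \<xi> = 0"
    if \<alpha>: "\<alpha> \<in> sections atlas A" and X: "X \<in> vector_fields atlas" and \<xi>: "\<xi> \<in> sections atlas K"
    for \<alpha> X \<xi>
  proof -
    note \<xi>A = ideal_sections[OF \<xi>]
    \<comment> \<open>The identity \<open>rep\<close> enters twice: for \<xi> itself, inside the
      derivative along \<open>X\<close>, and for the section \<open>apply_map (C \<xi>) X\<close> of
      \<kk>. The remaining curvature term, along the bracket of vector fields, completes the Lie
      derivative.\<close>
    have "curvature atlas (induced_connection C) (apply_map anchor \<alpha>) X \<xi> =
        lie_derivative atlas anchor bracket \<alpha> (C \<xi>) X - apply_map (C (bracket \<alpha> \<xi>)) X"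
      using rep[OF \<alpha> \<xi>] rep[OF \<alpha> C_section[OF \<xi>A X]]
      by (simp add: curvature_def induced_connection_def lie_derivative_def)
    also have "\<dots> = lie_derivative atlas anchor bracket \<xi> (C \<alpha>) X"
      by (simp add: C_bracket[OF \<alpha> \<xi>A X])
    also have "\<dots> = 0"
      by (simp add: lie_derivative_def ab[OF \<xi> C_section[OF \<alpha> X]] anchor_ideal_section[OF \<xi>]
          vf_bracket_zero_left[OF X] C_zero[OF \<alpha> X])
    finally show ?thesis .
  qed
  then show ?thesis
    using linear_connection_induced rep
    by (auto simp: A_invariant_def ideal_rep_def induced_connection_def)
qed

end

theorem proposition4p3:
  fixes atlas :: "('m, 'e::finite_dim_normed) chart set"
    and A :: "('m, 'a::real_vector, 'f::finite_dim_normed) vbundle"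
    and anchor :: "'m \<Rightarrow> 'a \<Rightarrow> ('m, 'e) tvec"
    and bracket :: "('m, 'a) section_bracket"
    and K :: "('m, 'a, 'g::finite_dim_normed) vbundle"
    and C :: "('m \<Rightarrow> 'a) \<Rightarrow> 'm \<Rightarrow> ('m, 'e) tvec \<Rightarrow> 'a"
    and v :: "'m \<Rightarrow> 'a \<Rightarrow> 'a"
  assumes "lie_algebroid atlas A anchor bracket"
    and "bundle_of_ideals atlas A anchor bracket K"
    and "IM_connection atlas A anchor bracket K C v"
  shows "A_invariant atlas A anchor bracket K (induced_connection C) \<longleftrightarrow>
    abelian_bundle atlas bracket K"
  using IM_connection.abelian_if_A_invariant[OF assms(3)]
    IM_connection.A_invariant_if_abelian[OF assms(3)] by blast

end
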